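(* Let $\mathcal{P}$ be a basic cell of a lattice $\mathbf{G}\mathbb{Z}^n$ ($\mathbf{G}\in\mathbb{R}^{n\times n}$ full-rank), let $\mathcal{A}\subseteq\mathcal{P}$ with $\mu(\mathcal{A})>0$, and consider the rejection-sampled universal quantizer (RSUQ) $(P_S,Q_{\mathcal{A},\mathcal{P}})$ for $\mathcal{A}$ against $\mathcal{P}$. Let $p:=\mu(\mathcal{A})/\mu(\mathcal{P})$. For a random input $\mathbf{X}$ satisfying $\mathbf{X}\in\mathcal{X}$ almost surely for some $\mathcal{X}\subseteq\mathbb{R}^n$ with $\mu(\mathcal{X})<\infty$, independent of $S\sim P_S$, the conditional entropy of the quantizer satisfies \[ H(Q_{\mathcal{A},\mathcal{P}}(\mathbf{X},S)\,|\,S)\le\log\mu(\mathcal{X}+\mathcal{A}+\mathcal{P}-\mathcal{P})-\log\mu(\mathcal{A})-\frac{1-p}{p}\log(1-p) \le\log\mu(\mathcal{X}+\mathcal{A}+\mathcal{P}-\mathcal{P})-\log\mu(\mathcal{A})+\log e. \] Hence, the normalized entropy satisfies \[ \overline{H}(Q_{\mathcal{A},\mathcal{P}})\le-\log\mu(\mathcal{A})-\frac{1-p}{p}\log(1-p)\le-\log\mu(\mathcal{A})+\log e. \]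
   Context: Conventions: $\log$ is to base $2$, $0\log0=0$; $H(\cdot|\cdot)$ is conditional Shannon entropy in bits; $\mu$ is Lebesgue measure on $\mathbb{R}^n$; sums and differences of sets are Minkowski: $\mathcal{A}+\mathcal{B}=\{\mathbf{x}+\mathbf{y}\}$, $\mathcal{A}-\mathcal{B}=\{\mathbf{x}-\mathbf{y}\}$ over $\mathbf{x}\in\mathcal{A},\mathbf{y}\in\mathcal{B}$; $B^n$ is the closed unit ball; sets are measurable as needed. A bounded set $\mathcal{P}\subseteq\mathbb{R}^n$ is a basic cell of $\mathbf{G}\mathbb{Z}^n$ if the translates $(\mathcal{P}+\mathbf{G}\mathbf{j})_{\mathbf{j}\in\mathbb{Z}^n}$ partition $\mathbb{R}^n$. For a basic cell $\mathcal{P}$, $Q_{\mathcal{P}}(\mathbf{x})$ is the unique lattice point $\mathbf{y}\in\mathbf{G}\mathbb{Z}^n$ with $\mathbf{x}\in-\mathcal{P}+\mathbf{y}$. RSUQ for $\mathcal{A}$ against $\mathcal{P}$: the state is $S=(\mathbf{V}_i)_{i\ge1}$ with $\mathbf{V}_1,\mathbf{V}_2,\ldots$ i.i.d. $\mathrm{Unif}(\mathcal{P})$, and $Q_{\mathcal{A},\mathcal{P}}(\mathbf{x},(\mathbf{v}_i)_i)=Q_{\mathcal{P}}(\mathbf{x}-\mathbf{v}_k)+\mathbf{v}_k$, where $k=\min\{i:Q_{\mathcal{P}}(\mathbf{x}-\mathbf{v}_i)+\mathbf{v}_i-\mathbf{x}\in\mathcal{A}\}$ (which exists almost surely for each fixed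 $\mathbf{x}$). Normalized entropy: $\overline{H}(Q):=\limsup_{\tau\to\infty}\big(H(Q(\mathbf{X}_\tau,S)|S)-\log\mu(\tau B^n)\big)$, where $\mathbf{X}_\tau\sim\mathrm{Unif}(\tau B^n)$ is independent of $S\sim P_S$. *)

theory Defs
  imports "HOL-Probability.Probability"
begin

definition lattice_index :: "(real ^ 'n) set" where
  "lattice_index = {j. \<forall>i. j $ i \<in> \<int>}"

definition lattice :: "real ^ 'n ^ 'n \<Rightarrow> (real ^ 'n) set" where
  "lattice G = (\<lambda>j. G *v j) ` lattice_index"

definition basic_cell :: "real ^ 'n ^ 'n \<Rightarrow> (real ^ 'n) set \<Rightarrow> bool" where
  "basic_cell G P \<longleftrightarrow>
     bounded P \<and>
     disjoint_family_on (\<lambda>j. (\<lambda>x. x + G *v j) ` P) lattice_index \<and>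
     (\<Union>j\<in>lattice_index. (\<lambda>x. x + G *v j) ` P) = UNIV"

definition cell_quantizer :: "real ^ 'n ^ 'n \<Rightarrow> (real ^ 'n) set \<Rightarrow> real ^ 'n \<Rightarrow> real ^ 'n" where
  "cell_quantizer G P x = (THE y. y \<in> lattice G \<and> x \<in> (\<lambda>z. - z + y) ` P)"

text \<open>The state sequence is indexed from 0. If no index is accepted, the minimum is
  the unspecified value of \<open>LEAST\<close> for the empty predicate; this has probability zero
  for every fixed input.\<close>

definition rsuq ::
  "real ^ 'n ^ 'n \<Rightarrow> (real ^ 'n) set \<Rightarrow> (real ^ 'n) set \<Rightarrow> real ^ 'n \<Rightarrow> (nat \<Rightarrow> real ^ 'n) \<Rightarrow> real ^ 'n"
  where
  "rsuq G A P x v =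
     (let k = (LEAST i. cell_quantizer G P (x - v i) + v i - x \<in> A)
      in cell_quantizer G P (x - v k) + v k)"

definition rsuq_state :: "(real ^ 'n) set \<Rightarrow> (nat \<Rightarrow> real ^ 'n) measure" where
  "rsuq_state P = Pi\<^sub>M UNIV (\<lambda>_. uniform_measure lborel P)"

text \<open>The entropies of the library are real-valued, hence 0 rather than infinite when the
  defining integral diverges, and its conditional entropy is relative to
  \<open>\<sigma>\<close>-finite reference measures. Here the output is only conditionally discrete:
  given the state it lies in a countable set that depends on the state. So entropy takes
  values in \<open>[0,\<infinity>]\<close>, and it is conditioned through regular conditional distributions.
  A distribution that is not discrete has infinite entropy.\<close>

definition shannon_entropy :: "'b measure \<Rightarrow> ennreal" where
  "shannon_entropy K =
     (if \<exists>C. countable C \<and> (AE y in K. y \<in> C)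
      then \<integral>\<^sup>+ y. ennreal (- (measure K {y} * log 2 (measure K {y}))) \<partial>count_space UNIV
      else \<infinity>)"

definition regular_cond_distr ::
  "'w measure \<Rightarrow> 's measure \<Rightarrow> 'b measure \<Rightarrow> ('w \<Rightarrow> 's) \<Rightarrow> ('w \<Rightarrow> 'b) \<Rightarrow> ('s \<Rightarrow> 'b measure) \<Rightarrow> bool"
  where
  "regular_cond_distr M N B S Y \<kappa> \<longleftrightarrow>
     \<kappa> \<in> N \<rightarrow>\<^sub>M prob_algebra B \<and>
     (\<forall>E\<in>sets N. \<forall>F\<in>sets B.
        emeasure M {w \<in> space M. S w \<in> E \<and> Y w \<in> F} =
        (\<integral>\<^sup>+ s\<in>E. emeasure (\<kappa> s) F \<partial>distr M N S))"

text \<open>\<open>H(Y | S)\<close> in bits. On a standard Borel space \<open>B\<close> a regular conditional distribution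
  exists and is unique up to null sets, so the choice does not affect the value.\<close>

definition cond_entropy ::
  "'w measure \<Rightarrow> 's measure \<Rightarrow> 'b measure \<Rightarrow> ('w \<Rightarrow> 's) \<Rightarrow> ('w \<Rightarrow> 'b) \<Rightarrow> ennreal"
  where
  "cond_entropy M N B S Y =
     (\<integral>\<^sup>+ s. shannon_entropy ((SOME \<kappa>. regular_cond_distr M N B S Y \<kappa>) s) \<partial>distr M N S)"

definition normalized_entropy ::
  "'s measure \<Rightarrow> (real ^ 'n \<Rightarrow> 's \<Rightarrow> real ^ 'n) \<Rightarrow> ereal" where
  "normalized_entropy PS Q =
     Limsup at_top (\<lambda>\<tau>::real.
       enn2ereal (cond_entropy (uniform_measure lborel (cball 0 \<tau>) \<Otimes>\<^sub>M PS) PS borel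
                    snd (\<lambda>(x, s). Q x s))
       - ereal (log 2 (measure lebesgue (cball (0 :: real ^ 'n) \<tau>))))"

definition elog2 :: "ennreal \<Rightarrow> ereal" where
  "elog2 m = (if m = 0 then -\<infinity> else if m = \<infinity> then \<infinity> else ereal (log 2 (enn2real m)))"

end

theory Submission
  imports Defs
begin

text \<open>Let \<open>K\<close> be the accepted round. For every fixed input the candidate errors are uniform on \<open>P\<close>,
  so \<open>K\<close> is geometric with parameter \<open>p\<close>. Given the state \<open>s\<close> and \<open>K = k\<close>, the output lies
  in the part of the lattice shifted by \<open>s k\<close> that meets \<open>\<X> + A\<close>; the cells around its points are
  disjoint, so it has at most \<open>N = \<mu>(D) / \<mu>(P)\<close> points. Gibbs' inequality against the
  weights \<open>p (1 - p)\<^sup>k / N\<close> bounds the entropy of the output given \<open>s\<close> by the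
  expectation of \<open>log N - log p - K log (1 - p)\<close>, and averaging over the state replaces \<open>K\<close>
  by \<open>(1 - p) / p\<close>. Comparing balls of radius \<open>\<tau>\<close> and \<open>\<tau> + O(1)\<close> gives the limit.\<close>

section \<open>Gibbs' inequality for a discrete random variable\<close>

text \<open>The inequality \<open>ln z \<le> z - 1\<close> at \<open>z = r y / q y\<close> compares
  the entropy with the cross entropy against the subprobability weights \<open>r\<close>. The cross
  entropy is written as an integral over \<open>M\<close>, so that \<open>r\<close> can later be
  estimated along the random output itself.\<close>

lemma shannon_entropy_distr_le:
  fixes f :: "'w \<Rightarrow> 'b :: t1_space" and r :: "'b \<Rightarrow> real"
  assumes "prob_space M" and f[measurable]: "f \<in> M \<rightarrow>\<^sub>M borel"
    and C: "countable C" "AE w in M. f w \<in> C"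
    and r_pos: "\<And>y. y \<in> C \<Longrightarrow> 0 < r y"
    and r_sum: "(\<integral>\<^sup>+ y. ennreal (r y) \<partial>count_space C) \<le> 1"
  shows "shannon_entropy (distr M borel f) \<le> (\<integral>\<^sup>+ w. ennreal (- log 2 (r (f w))) \<partial>M)"
proof -
  interpret prob_space M by fact
  let ?K = "distr M borel f"
  interpret K: prob_space ?K by (rule prob_space_distr) measurable
  define q where "q y = measure ?K {y}" for y
  have C_sets[measurable]: "C \<in> sets borel"
    using C(1) by (rule sets.countable[rotated]) simp
  have AE_C: "AE y in ?K. y \<in> C"
    using C(2) by (subst AE_distr_iff) auto
  have q_out: "q y = 0" if "y \<notin> C" for y
  proof -
    have "emeasure ?K {y} = emeasure ?K {}"
      using AE_C that by (intro emeasure_eq_AE) auto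
    then show ?thesis by (simp add: q_def measure_def)
  qed
  have q0: "0 \<le> q y" "q y \<le> 1" for y by (auto simp: q_def)
  \<comment> \<open>Hence \<open>- log 2 (r y)\<close> is nonnegative on \<open>C\<close> and
    \<open>ennreal\<close> does not truncate it.\<close>
  have r_le: "r y \<le> 1" if "y \<in> C" for y
  proof -
    have "ennreal (r y) = (\<integral>\<^sup>+ z. ennreal (r z) * indicator {y} z \<partial>count_space C)"
      using that by (simp add: nn_integral_indicator_singleton')
    also have "\<dots> \<le> (\<integral>\<^sup>+ z. ennreal (r z) \<partial>count_space C)"
      by (intro nn_integral_mono) (auto split: split_indicator)
    finally show ?thesis using r_sum by (metis ennreal_le_1 order_trans)
  qed
  have q_sum: "(\<integral>\<^sup>+ y. ennreal (q y) \<partial>count_space C) = 1"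
  proof -
    have "(\<integral>\<^sup>+ y. ennreal (q y) \<partial>count_space C) = emeasure ?K C"
      unfolding q_def using C(1)
      by (subst emeasure_countable_singleton) (auto simp: K.emeasure_eq_measure)
    also have "\<dots> = 1"
      using AE_C by (intro K.emeasure_eq_1_AE) auto
    finally show ?thesis .
  qed
  \<comment> \<open>The terms \<open>q y / ln 2\<close> and \<open>r y / ln 2\<close> stand on
    opposite sides so that everything is nonnegative and no subtraction in \<open>ennreal\<close>
    occurs. Summed over \<open>C\<close> they give \<open>1 / ln 2\<close> and at most
    \<open>1 / ln 2\<close>, so this finite constant cancels afterwards.\<close>
  have pt: "ennreal (- (q y * log 2 (q y))) + ennreal (q y / ln 2)
      \<le> ennreal (- log 2 (r y)) * ennreal (q y) + ennreal (r y / ln 2)" if y: "y \<in> C" for y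
  proof -
    have l2: "(0::real) < ln 2" by simp
    have "q y * ln (r y) - q y * ln (q y) \<le> r y - q y"
    proof (cases "q y = 0")
      case True then show ?thesis using r_pos[OF y] by simp
    next
      case False
      then have "0 < q y" using q0[of y] by simp
      moreover have "ln (r y / q y) \<le> r y / q y - 1"
        using \<open>0 < q y\<close> r_pos[OF y] by (intro ln_le_minus_one) simp
      ultimately have "q y * ln (r y / q y) \<le> r y - q y"
        by (simp add: field_simps)
      then show ?thesis using \<open>0 < q y\<close> r_pos[OF y] by (simp add: ln_div algebra_simps)
    qed
    then have "(- (q y * ln (q y)) + q y) / ln 2 \<le> (- ln (r y) * q y + r y) / ln 2"
      using l2 by (intro divide_right_mono) (auto simp: algebra_simps)
    then have "- (q y * log 2 (q y)) + q y / ln 2 \<le> - log 2 (r y) * q y + r y / ln 2"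
      by (simp add: log_def add_divide_distrib diff_divide_distrib mult.commute)
    moreover have "0 \<le> - (q y * log 2 (q y))"
      using q0[of y] by (cases "q y = 0") (auto simp: mult_le_0_iff)
    moreover have "0 \<le> - log 2 (r y)" using r_pos[OF y] r_le[OF y] by simp
    ultimately have "ennreal (- (q y * log 2 (q y))) + ennreal (q y / ln 2)
        \<le> ennreal (- log 2 (r y) * q y + r y / ln 2)"
      using q0[of y] by (subst ennreal_plus[symmetric]) (auto intro!: ennreal_leI)
    also have "\<dots> = ennreal (- log 2 (r y) * q y) + ennreal (r y / ln 2)"
      using \<open>0 \<le> - log 2 (r y)\<close> q0[of y] r_pos[OF y]
      by (intro ennreal_plus mult_nonneg_nonneg) auto
    also have "ennreal (- log 2 (r y) * q y) = ennreal (- log 2 (r y)) * ennreal (q y)"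
      using \<open>0 \<le> - log 2 (r y)\<close> q0[of y] by (intro ennreal_mult) auto
    finally show ?thesis .
  qed
  have "shannon_entropy ?K = (\<integral>\<^sup>+ y. ennreal (- (q y * log 2 (q y))) \<partial>count_space UNIV)"
    unfolding shannon_entropy_def q_def using AE_C C(1) by auto
  also have "\<dots> = (\<integral>\<^sup>+ y. ennreal (- (q y * log 2 (q y))) \<partial>count_space C)"
    by (intro nn_integral_count_space_eq) (auto simp: q_out)
  finally have H: "shannon_entropy ?K = (\<integral>\<^sup>+ y. ennreal (- (q y * log 2 (q y))) \<partial>count_space C)" .
  have div: "(\<integral>\<^sup>+ y. ennreal (h y / ln 2) \<partial>count_space C)
      = (\<integral>\<^sup>+ y. ennreal (h y) \<partial>count_space C) * ennreal (1 / ln 2)" for h :: "'b \<Rightarrow> real"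
    by (subst nn_integral_multc[symmetric]) (auto simp: divide_inverse simp flip: ennreal_mult'')
  have "shannon_entropy ?K + ennreal (1 / ln 2)
      = (\<integral>\<^sup>+ y. ennreal (- (q y * log 2 (q y))) + ennreal (q y / ln 2) \<partial>count_space C)"
    by (simp add: H nn_integral_add div q_sum)
  also have "\<dots> \<le> (\<integral>\<^sup>+ y. ennreal (- log 2 (r y)) * ennreal (q y) + ennreal (r y / ln 2) \<partial>count_space C)"
    by (intro nn_integral_mono pt) auto
  also have "\<dots> = (\<integral>\<^sup>+ y. ennreal (- log 2 (r y)) * ennreal (q y) \<partial>count_space C)
      + (\<integral>\<^sup>+ y. ennreal (r y) \<partial>count_space C) * ennreal (1 / ln 2)"
    by (simp add: nn_integral_add div)
  also have "\<dots> \<le> (\<integral>\<^sup>+ y. ennreal (- log 2 (r y)) * ennreal (q y) \<partial>count_space C) + ennreal (1 / ln 2)"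
    using mult_right_mono[OF r_sum, of "ennreal (1 / ln 2)"] by (intro add_left_mono) simp
  finally have "shannon_entropy ?K \<le> (\<integral>\<^sup>+ y. ennreal (- log 2 (r y)) * ennreal (q y) \<partial>count_space C)"
    by (simp add: ennreal_add_left_cancel_le add.commute[of _ "ennreal (1 / ln 2)"])
  \<comment> \<open>Each \<open>q y\<close> becomes the \<open>M\<close>-probability of
    \<open>f w = y\<close>. Once sum and integral are exchanged, only the term
    \<open>y = f w\<close> remains for almost every \<open>w\<close>.\<close>
  also have "\<dots> = (\<integral>\<^sup>+ y. \<integral>\<^sup>+ w. ennreal (- log 2 (r y)) * indicator {y} (f w) \<partial>M \<partial>count_space C)"
  proof (intro nn_integral_cong)
    fix y
    have "(\<integral>\<^sup>+ w. indicator {y} (f w) \<partial>M) = (\<integral>\<^sup>+ w. indicator {y} w \<partial>?K)"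
      by (subst nn_integral_distr) auto
    then have "(\<integral>\<^sup>+ w. indicator {y} (f w) \<partial>M) = ennreal (q y)"
      by (simp add: q_def K.emeasure_eq_measure)
    then show "ennreal (- log 2 (r y)) * ennreal (q y)
        = (\<integral>\<^sup>+ w. ennreal (- log 2 (r y)) * indicator {y} (f w) \<partial>M)"
      by (subst nn_integral_cmult) auto
  qed
  also have "\<dots> = (\<integral>\<^sup>+ w. \<integral>\<^sup>+ y. ennreal (- log 2 (r y)) * indicator {y} (f w) \<partial>count_space C \<partial>M)"
    by (intro nn_integral_count_space_nn_integral[symmetric] C) measurable
  also have "\<dots> = (\<integral>\<^sup>+ w. ennreal (- log 2 (r (f w))) \<partial>M)"
  proof (rule nn_integral_cong_AE, use C(2) in eventually_elim)
    fix w assume w: "f w \<in> C"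
    have "(\<integral>\<^sup>+ y. ennreal (- log 2 (r y)) * indicator {y} (f w) \<partial>count_space C)
       = (\<integral>\<^sup>+ y. ennreal (- log 2 (r y)) * indicator {f w} y \<partial>count_space C)"
      by (intro nn_integral_cong) (auto split: split_indicator)
    also have "\<dots> = ennreal (- log 2 (r (f w)))"
      using w by (simp add: nn_integral_indicator_singleton')
    finally show "(\<integral>\<^sup>+ y. ennreal (- log 2 (r y)) * indicator {y} (f w) \<partial>count_space C)
       = ennreal (- log 2 (r (f w)))" .
  qed
  finally show ?thesis .
qed

section \<open>Regular conditional distributions and independence\<close>

text \<open>Finite intersections of a countable basis do it; the empty intersection contributes
  \<open>UNIV\<close>. Countability matters because two kernels will be compared set by set, each
  time outside a null set.\<close>

lemma borel_countable_Int_stable_generator: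
  obtains E :: "'b :: second_countable_topology set set"
  where "countable E" "Int_stable E" "UNIV \<in> E" "sets borel = sigma_sets UNIV E"
proof -
  obtain B :: "'b set set" where B: "countable B" "topological_basis B"
    using ex_countable_basis by blast
  let ?E = "Inter ` {b. finite b \<and> b \<subseteq> B}"
  have 1: "countable ?E"
    by (intro countable_image countable_Collect_finite_subset B)
  have 2: "Int_stable ?E"
  proof (rule Int_stableI_image)
    fix b c assume "b \<in> {b. finite b \<and> b \<subseteq> B}" "c \<in> {b. finite b \<and> b \<subseteq> B}"
    then show "\<exists>d\<in>{b. finite b \<and> b \<subseteq> B}. \<Inter> b \<inter> \<Inter> c = \<Inter> d"
      by (intro bexI[of _ "b \<union> c"]) auto
  qed
  have 3: "UNIV \<in> ?E" by (intro image_eqI[of _ _ "{}"]) auto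
  have "b \<in> ?E" if "b \<in> B" for b
    using that by (intro image_eqI[of _ _ "{b}"]) auto
  then have BE: "B \<subseteq> ?E" by blast
  have op: "open X" if "X \<in> ?E" for X
    using that topological_basis_open[OF B(2)] by (auto intro!: open_Inter)
  have "sets (borel :: 'b measure) = sigma_sets UNIV B"
    by (subst borel_eq_countable_basis[OF B]) simp
  then have 4: "sets (borel :: 'b measure) = sigma_sets UNIV ?E"
    using sigma_sets_mono'[OF BE, of UNIV] op
    by (intro antisym sets.sigma_sets_subset[of ?E borel, simplified space_borel]) auto
  show ?thesis by (rule that[OF 1 2 3 4])
qed

text \<open>For each fixed set \<open>F\<close> the two kernels have the same integrals over all
  measurable sets of states, so they agree on \<open>F\<close> almost everywhere. A countable
  generator merges the exceptional null sets into one, and its stability under intersection extends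
  the agreement to all Borel sets.\<close>

lemma regular_cond_distr_unique:
  fixes \<kappa> \<kappa>' :: "'s \<Rightarrow> 'b :: second_countable_topology measure"
  assumes "prob_space M" and S: "S \<in> M \<rightarrow>\<^sub>M N"
    and K: "regular_cond_distr M N borel S Y \<kappa>" and K': "regular_cond_distr M N borel S Y \<kappa>'"
  shows "AE s in distr M N S. \<kappa> s = \<kappa>' s"
proof -
  interpret prob_space M by fact
  interpret D: prob_space "distr M N S" by (rule prob_space_distr) fact
  obtain E :: "'b set set" where E: "countable E" "Int_stable E" "UNIV \<in> E" "sets borel = sigma_sets UNIV E"
    by (rule borel_countable_Int_stable_generator)
  have \<kappa>: "\<kappa> \<in> N \<rightarrow>\<^sub>M prob_algebra borel" and \<kappa>': "\<kappa>' \<in> N \<rightarrow>\<^sub>M prob_algebra borel"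
    using K K' by (auto simp: regular_cond_distr_def)
  have m: "(\<lambda>s. emeasure (k s) F) \<in> borel_measurable (distr M N S)"
    if "k \<in> N \<rightarrow>\<^sub>M prob_algebra borel" "F \<in> sets borel" for k and F :: "'b set"
    using measurable_emeasure_kernel[OF measurable_prob_algebraD[OF that(1)] that(2)] by simp
  have "AE s in distr M N S. emeasure (\<kappa> s) F = emeasure (\<kappa>' s) F" if F: "F \<in> E" for F
  proof (rule D.density_unique2)
    have F': "F \<in> sets borel" using F by (simp add: E(4))
    show "(\<lambda>s. emeasure (\<kappa> s) F) \<in> borel_measurable (distr M N S)"
         "(\<lambda>s. emeasure (\<kappa>' s) F) \<in> borel_measurable (distr M N S)"
      using m[OF \<kappa> F'] m[OF \<kappa>' F'] .
    fix A assume "A \<in> sets (distr M N S)"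
    then show "(\<integral>\<^sup>+ s\<in>A. emeasure (\<kappa> s) F \<partial>distr M N S) = (\<integral>\<^sup>+ s\<in>A. emeasure (\<kappa>' s) F \<partial>distr M N S)"
      using K K' F' unfolding regular_cond_distr_def sets_distr by (auto dest!: bspec)
  qed
  then have "AE s in distr M N S. \<forall>F\<in>E. emeasure (\<kappa> s) F = emeasure (\<kappa>' s) F"
    using E(1) by (simp add: AE_ball_countable)
  then show ?thesis
  proof (rule AE_mp, intro AE_I2 impI)
    fix s assume s: "s \<in> space (distr M N S)" and eq: "\<forall>F\<in>E. emeasure (\<kappa> s) F = emeasure (\<kappa>' s) F"
    have k: "\<kappa> s \<in> space (prob_algebra borel)" "\<kappa>' s \<in> space (prob_algebra borel)"
      using measurable_space[OF \<kappa>] measurable_space[OF \<kappa>'] s by auto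
    show "\<kappa> s = \<kappa>' s"
    proof (rule measure_eqI_generator_eq[where E = E and \<Omega> = UNIV and A = "\<lambda>_::nat. UNIV"])
      show "emeasure (\<kappa> s) UNIV \<noteq> \<infinity>"
        using k(1) finite_measure.emeasure_finite[OF prob_space.finite_measure, of "\<kappa> s" UNIV]
        by (auto simp: space_prob_algebra)
    qed (use k E eq in \<open>auto simp: space_prob_algebra\<close>)
  qed
qed

text \<open>This frees \<open>cond_entropy\<close> from its choice operator: the entropy may be
  computed from any explicit version of the conditional distribution.\<close>

lemma cond_entropy_eq:
  fixes \<kappa> :: "'s \<Rightarrow> 'b :: second_countable_topology measure"
  assumes "prob_space M" "S \<in> M \<rightarrow>\<^sub>M N" "regular_cond_distr M N borel S Y \<kappa>"
  shows "cond_entropy M N borel S Y = (\<integral>\<^sup>+ s. shannon_entropy (\<kappa> s) \<partial>distr M N S)"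
proof -
  have "regular_cond_distr M N borel S Y (SOME \<kappa>. regular_cond_distr M N borel S Y \<kappa>)"
    by (rule someI[where P = "regular_cond_distr M N borel S Y"]) (rule assms(3))
  from regular_cond_distr_unique[OF assms(1,2) this assms(3)] show ?thesis
    unfolding cond_entropy_def by (intro nn_integral_cong_AE) (auto elim: eventually_mono)
qed

text \<open>Under independence, conditioning on the state amounts to freezing it: the joint law is a
  product, and slicing a measurable set at \<open>s\<close> gives the law of
  \<open>f (X w) s\<close>.\<close>

lemma regular_cond_distr_indep:
  assumes "prob_space M" and X[measurable]: "X \<in> M \<rightarrow>\<^sub>M B" and S[measurable]: "S \<in> M \<rightarrow>\<^sub>M N"
    and joint: "distr M B X \<Otimes>\<^sub>M distr M N S = distr M (B \<Otimes>\<^sub>M N) (\<lambda>w. (X w, S w))"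
    and f: "(\<lambda>(x, s). f x s) \<in> B \<Otimes>\<^sub>M N \<rightarrow>\<^sub>M C"
  shows "regular_cond_distr M N C S (\<lambda>w. f (X w) (S w)) (\<lambda>s. distr M C (\<lambda>w. f (X w) s))"
proof -
  interpret prob_space M by fact
  interpret PX: prob_space "distr M B X" by (rule prob_space_distr) measurable
  interpret PS: prob_space "distr M N S" by (rule prob_space_distr) measurable
  interpret pair_sigma_finite "distr M B X" "distr M N S" ..
  note f[measurable]
  have fs: "(\<lambda>w. f (X w) s) \<in> M \<rightarrow>\<^sub>M C" if "s \<in> space N" for s
    using that measurable_compose[OF _ f, of "\<lambda>w. (X w, s)" M] by simp
  have "(\<lambda>s. distr M C (\<lambda>w. f (X w) s)) \<in> N \<rightarrow>\<^sub>M prob_algebra C"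
  proof (rule measurable_prob_algebraI)
    show "prob_space (distr M C (\<lambda>w. f (X w) s))" if "s \<in> space N" for s
      using fs[OF that] by (rule prob_space_distr)
    have "(\<lambda>z. (X (snd z), fst z)) \<in> N \<Otimes>\<^sub>M M \<rightarrow>\<^sub>M B \<Otimes>\<^sub>M N" by measurable
    from measurable_compose[OF this f]
    show "(\<lambda>s. distr M C (\<lambda>w. f (X w) s)) \<in> N \<rightarrow>\<^sub>M subprob_algebra C"
      by (intro measurable_distr2[where M = M and g = "\<lambda>_. M"])
        (auto simp: case_prod_beta space_subprob_algebra intro!: measurable_const subprob_space_axioms)
  qed
  moreover have "emeasure M {w \<in> space M. S w \<in> E \<and> f (X w) (S w) \<in> F} =
        (\<integral>\<^sup>+ s\<in>E. emeasure (distr M C (\<lambda>w. f (X w) s)) F \<partial>distr M N S)"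
    if [measurable]: "E \<in> sets N" "F \<in> sets C" for E F
  proof -
    let ?A = "{z \<in> space (B \<Otimes>\<^sub>M N). snd z \<in> E \<and> (case z of (x, s) \<Rightarrow> f x s) \<in> F}"
    have A[measurable]: "?A \<in> sets (B \<Otimes>\<^sub>M N)" by measurable
    have "emeasure M {w \<in> space M. S w \<in> E \<and> f (X w) (S w) \<in> F}
        = emeasure (distr M (B \<Otimes>\<^sub>M N) (\<lambda>w. (X w, S w))) ?A"
      by (subst emeasure_distr)
        (auto intro!: arg_cong[where f = "emeasure M"] simp: space_pair_measure measurable_space[OF X] measurable_space[OF S])
    also have "\<dots> = (\<integral>\<^sup>+ s. emeasure (distr M B X) ((\<lambda>x. (x, s)) -` ?A) \<partial>distr M N S)"
      unfolding joint[symmetric] by (rule emeasure_pair_measure_alt2) measurable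
    also have "\<dots> = (\<integral>\<^sup>+ s\<in>E. emeasure (distr M C (\<lambda>w. f (X w) s)) F \<partial>distr M N S)"
    proof (rule nn_integral_cong)
      fix s assume "s \<in> space (distr M N S)"
      then have s: "s \<in> space N" by simp
      have "(\<lambda>x. (x, s)) -` ?A \<in> sets B"
        using sets_Pair2[OF A, of s] .
      then have "emeasure (distr M B X) ((\<lambda>x. (x, s)) -` ?A) = emeasure M {w \<in> space M. s \<in> E \<and> f (X w) s \<in> F}"
        using s by (subst emeasure_distr)
          (auto intro!: arg_cong[where f = "emeasure M"] simp: space_pair_measure measurable_space[OF X])
      also have "\<dots> = emeasure (distr M C (\<lambda>w. f (X w) s)) F * indicator E s"
        using fs[OF s] by (subst emeasure_distr)
          (auto intro!: arg_cong[where f = "emeasure M"] split: split_indicator)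
      finally show "emeasure (distr M B X) ((\<lambda>x. (x, s)) -` ?A)
        = emeasure (distr M C (\<lambda>w. f (X w) s)) F * indicator E s" .
    qed
    finally show ?thesis .
  qed
  ultimately show ?thesis by (simp add: regular_cond_distr_def)
qed


text \<open>The library's \<open>indep_var_distribution_eq\<close> only covers two variables with values in the same type.\<close>

lemma (in prob_space) indep_set_imp_distr_pair:
  assumes X[measurable]: "X \<in> M \<rightarrow>\<^sub>M B" and S[measurable]: "S \<in> M \<rightarrow>\<^sub>M N"
    and indep: "indep_set (sets (vimage_algebra (space M) X B)) (sets (vimage_algebra (space M) S N))"
  shows "distr M B X \<Otimes>\<^sub>M distr M N S = distr M (B \<Otimes>\<^sub>M N) (\<lambda>w. (X w, S w))"
proof (rule pair_measure_eqI)
  show "sigma_finite_measure (distr M B X)" "sigma_finite_measure (distr M N S)"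
    by (auto intro!: prob_space_imp_sigma_finite prob_space_distr)
  fix E F assume "E \<in> sets (distr M B X)" "F \<in> sets (distr M N S)"
  then have EF[measurable]: "E \<in> sets B" "F \<in> sets N" by auto
  have "prob ((X -` E \<inter> space M) \<inter> (S -` F \<inter> space M)) = prob (X -` E \<inter> space M) * prob (S -` F \<inter> space M)"
    using indep EF by (intro indep_setD) (auto intro: in_vimage_algebra)
  moreover have "(\<lambda>w. (X w, S w)) -` (E \<times> F) \<inter> space M = (X -` E \<inter> space M) \<inter> (S -` F \<inter> space M)"
    by auto
  ultimately show "emeasure (distr M B X) E * emeasure (distr M N S) F
      = emeasure (distr M (B \<Otimes>\<^sub>M N) (\<lambda>w. (X w, S w))) (E \<times> F)"
    by (simp add: emeasure_distr emeasure_eq_measure ennreal_mult)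
qed (simp cong: sets_pair_measure_cong)

section \<open>Lattice indices and translation of Lebesgue measure\<close>

lemma lattice_index_minus: "- j \<in> lattice_index \<longleftrightarrow> j \<in> lattice_index"
  using Ints_minus by (fastforce simp: lattice_index_def)

lemma matrix_vector_mult_uminus: "G *v (- j) = - (G *v j)" for G :: "real ^ 'n ^ 'm"
  by (rule linear_neg[OF matrix_vector_mul_linear])

lemma countable_lattice_index: "countable (lattice_index :: (real ^ 'n) set)"
proof (rule countable_subset)
  show "(lattice_index :: (real ^ 'n) set) \<subseteq> range (\<lambda>f :: 'n \<Rightarrow> int. \<chi> i. of_int (f i))"
  proof
    fix j :: "real ^ 'n" assume "j \<in> lattice_index"
    then have "j = (\<chi> i. of_int \<lfloor>j $ i\<rfloor>)"
      by (auto simp: lattice_index_def vec_eq_iff elim!: Ints_cases)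
    then show "j \<in> range (\<lambda>f :: 'n \<Rightarrow> int. \<chi> i. of_int (f i))" by (rule range_eqI[where x = "\<lambda>i. \<lfloor>j $ i\<rfloor>"])
  qed
qed simp

lemma emeasure_lborel_translate:
  fixes c :: "'a :: euclidean_space"
  assumes "E \<in> sets borel"
  shows "emeasure lborel {v. v + c \<in> E} = emeasure lborel E"
proof -
  have "emeasure lborel E = emeasure (distr lborel borel ((+) c)) E"
    by (simp add: lborel_distr_plus)
  also have "\<dots> = emeasure lborel {v. v + c \<in> E}"
    using assms by (subst emeasure_distr) (auto simp: vimage_def add.commute)
  finally show ?thesis by simp
qed

text \<open>Since \<open>ennreal\<close> sends negative numbers to 0, equality can fail for negative
  \<open>a\<close>. The inequality is applied where the sign of the first summand has not been
  established.\<close>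

lemma ennreal_add_le: "ennreal (a + b) \<le> ennreal a + ennreal b" if "0 \<le> b"
proof (cases "0 \<le> a")
  case False
  with that have "ennreal (a + b) \<le> ennreal b" by (intro ennreal_leI) simp
  then show ?thesis by (rule order_trans) simp
qed (use that in simp)

section \<open>Basic cells and their quantizer\<close>

locale cell_subset =
  fixes G :: "real ^ 'n ^ 'n" and P A :: "(real ^ 'n) set" and p :: real
  assumes cell: "basic_cell G P"
    and P_borel[measurable]: "P \<in> sets borel"
    and A_borel[measurable]: "A \<in> sets borel"
    and A_sub: "A \<subseteq> P"
    and A_pos: "measure lebesgue A > 0"
    and p_def: "p = measure lebesgue A / measure lebesgue P"
begin

lemma bounded_P: "bounded P"
  using cell by (simp add: basic_cell_def)

lemma emeasure_P_A: "emeasure lborel P = ennreal (measure lebesgue P)"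
    "emeasure lborel A = ennreal (measure lebesgue A)"
  using emeasure_bounded_finite[OF bounded_P] emeasure_bounded_finite[OF bounded_subset[OF bounded_P A_sub]]
  by (auto simp: emeasure_eq_ennreal_measure less_top)

lemma measure_A_le_P: "measure lebesgue A \<le> measure lebesgue P"
proof -
  have "emeasure lborel A \<le> emeasure lborel P"
    using A_sub by (intro emeasure_mono) auto
  then show ?thesis by (simp add: emeasure_P_A)
qed

lemma P_pos: "measure lebesgue P > 0"
  using A_pos measure_A_le_P by linarith

lemma p_pos: "0 < p" and p_le_1: "p \<le> 1"
  using A_pos P_pos measure_A_le_P by (auto simp: p_def)

text \<open>The quantizer works with the reflected cell, so the covering property is used at
  \<open>- x\<close> and the index found there is negated.\<close>

lemma cover: obtains j where "j \<in> lattice_index" "G *v j - x \<in> P"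
proof -
  have "- x \<in> (\<Union>j\<in>lattice_index. (\<lambda>x. x + G *v j) ` P)"
    using cell by (simp add: basic_cell_def)
  then obtain j u where "j \<in> lattice_index" "u \<in> P" "- x = u + G *v j" by auto
  then have "u = - x - G *v j" by simp
  moreover have "G *v (- j) - x = - x - G *v j"
    by (simp add: matrix_vector_mult_uminus)
  ultimately have "G *v (- j) - x \<in> P"
    using \<open>u \<in> P\<close> by metis
  with \<open>j \<in> lattice_index\<close> show ?thesis
    by (intro that[of "- j"]) (auto simp: lattice_index_minus)
qed

lemma translates_disjoint:
  assumes "i \<in> lattice_index" "j \<in> lattice_index" "u \<in> P" "v \<in> P" "u + G *v i = v + G *v j"
  shows "i = j"
proof (rule ccontr)
  assume "i \<noteq> j"
  with cell assms(1,2) have "(\<lambda>x. x + G *v i) ` P \<inter> (\<lambda>x. x + G *v j) ` P = {}"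
    by (auto simp: basic_cell_def disjoint_family_on_def)
  moreover have "u + G *v i \<in> (\<lambda>x. x + G *v i) ` P" "u + G *v i \<in> (\<lambda>x. x + G *v j) ` P"
    using imageI[OF assms(3), of "\<lambda>x. x + G *v i"] imageI[OF assms(4), of "\<lambda>x. x + G *v j"] assms(5)
    by simp_all
  ultimately show False by blast
qed

lemma index_unique:
  assumes "i \<in> lattice_index" "j \<in> lattice_index" "G *v i - x \<in> P" "G *v j - x \<in> P"
  shows "i = j"
  using translates_disjoint[of "j" "i" "G *v i - x" "G *v j - x"] assms by simp

lemma cell_quantizer_eq:
  assumes "j \<in> lattice_index" "G *v j - x \<in> P"
  shows "cell_quantizer G P x = G *v j"
  unfolding cell_quantizer_def
proof (rule the_equality)
  show "G *v j \<in> lattice G \<and> x \<in> (\<lambda>z. - z + G *v j) ` P"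
    using assms by (auto simp: lattice_def intro!: image_eqI[of _ _ "G *v j - x"])
  fix y assume y: "y \<in> lattice G \<and> x \<in> (\<lambda>z. - z + y) ` P"
  then obtain i where i: "i \<in> lattice_index" "y = G *v i" by (auto simp: lattice_def)
  with y have "G *v i - x \<in> P" by auto
  with i assms index_unique show "y = G *v j" by blast
qed

text \<open>The quantizer takes countably many values, each on a reflected translate of
  \<open>P\<close>.\<close>

lemma measurable_cell_quantizer[measurable]: "cell_quantizer G P \<in> borel \<rightarrow>\<^sub>M borel"
proof (rule measurableI)
  fix E :: "(real ^ 'n) set" assume "E \<in> sets borel"
  have "cell_quantizer G P -` E \<inter> space borel = (\<Union>j\<in>{j\<in>lattice_index. G *v j \<in> E}. {x. G *v j - x \<in> P})"
  proof (intro equalityI subsetI)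
    fix x assume x: "x \<in> cell_quantizer G P -` E \<inter> space borel"
    obtain j where j: "j \<in> lattice_index" "G *v j - x \<in> P" by (rule cover)
    with x show "x \<in> (\<Union>j\<in>{j\<in>lattice_index. G *v j \<in> E}. {x. G *v j - x \<in> P})"
      using cell_quantizer_eq[OF j] by auto
  qed (auto simp: cell_quantizer_eq)
  also have "\<dots> \<in> sets borel"
    by (intro sets.countable_UN' countable_subset[OF _ countable_lattice_index]) auto
  finally show "cell_quantizer G P -` E \<inter> space borel \<in> sets borel" .
qed simp

section \<open>Acceptance of a single candidate\<close>

definition accepts :: "real ^ 'n \<Rightarrow> real ^ 'n \<Rightarrow> bool" where
  "accepts x v \<longleftrightarrow> cell_quantizer G P (x - v) + v - x \<in> A"

text \<open>Counting from 0, this is the number of rejections before the first acceptance, which is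
  why \<open>(1 - p) / p\<close> and not \<open>1 / p\<close> bounds its mean.\<close>

definition round_index :: "real ^ 'n \<Rightarrow> (nat \<Rightarrow> real ^ 'n) \<Rightarrow> nat" where
  "round_index x s = (LEAST i. accepts x (s i))"

lemma rsuq_eq: "rsuq G A P x s = cell_quantizer G P (x - s (round_index x s)) + s (round_index x s)"
  by (simp add: rsuq_def round_index_def accepts_def Let_def)

text \<open>Because \<open>A \<subseteq> P\<close>, a lattice point whose error lies in
  \<open>A\<close> is already the one that \<open>cell_quantizer\<close> selects. Acceptance thus
  becomes membership of \<open>v\<close> in a union of translates of \<open>A\<close>, free of the
  definite description.\<close>

lemma accepts_iff: "accepts x v \<longleftrightarrow> (\<exists>j\<in>lattice_index. G *v j + v - x \<in> A)"
proof
  assume a: "accepts x v"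
  obtain j where j: "j \<in> lattice_index" "G *v j - (x - v) \<in> P" by (rule cover)
  with a show "\<exists>j\<in>lattice_index. G *v j + v - x \<in> A"
    by (auto simp: accepts_def cell_quantizer_eq)
next
  assume "\<exists>j\<in>lattice_index. G *v j + v - x \<in> A"
  then obtain j where j: "j \<in> lattice_index" "G *v j + v - x \<in> A" by blast
  then have "cell_quantizer G P (x - v) = G *v j"
    using A_sub by (intro cell_quantizer_eq) (auto simp: algebra_simps)
  with j show "accepts x v" by (simp add: accepts_def)
qed

lemma measurable_accepts[measurable]:
  assumes [measurable]: "f \<in> M \<rightarrow>\<^sub>M borel" "g \<in> M \<rightarrow>\<^sub>M borel"
  shows "Measurable.pred M (\<lambda>w. accepts (f w) (g w))"
  unfolding accepts_def by measurable

abbreviation U where "U \<equiv> uniform_measure lborel P"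

lemma prob_space_U: "prob_space U"
  using P_pos by (intro prob_space_uniform_measure) (auto simp: emeasure_P_A)

text \<open>The lattice index cuts the accepted part of \<open>P\<close> into pieces, each of which
  a translation moves into \<open>A\<close>. The moved pieces are the intersections of
  \<open>A\<close> with the cells of one shifted tiling, so they reassemble to \<open>A\<close>,
  whatever \<open>x\<close> is.\<close>

lemma emeasure_accepts: "emeasure U {v. accepts x v} = ennreal p"
proof -
  let ?I = "lattice_index :: (real ^ 'n) set"
  have "emeasure lborel (P \<inter> {v. accepts x v}) = emeasure lborel (\<Union>j\<in>?I. P \<inter> {v. v + (G *v j - x) \<in> A})"
    by (intro arg_cong[where f = "emeasure lborel"]) (auto simp: accepts_iff algebra_simps)
  also have "\<dots> = (\<integral>\<^sup>+ j. emeasure lborel (P \<inter> {v. v + (G *v j - x) \<in> A}) \<partial>count_space ?I)"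
  proof (rule emeasure_UN_countable[OF _ countable_lattice_index])
    show "disjoint_family_on (\<lambda>j. P \<inter> {v. v + (G *v j - x) \<in> A}) ?I"
      using A_sub index_unique[of _ _ "x - _"]
      by (force simp: disjoint_family_on_def algebra_simps)
  qed measurable
  \<comment> \<open>Piece \<open>j\<close> is moved by \<open>G *v j - x\<close>. The condition
    \<open>v \<in> P\<close> turns into \<open>a - (G *v j - x) \<in> P\<close>, written with
    \<open>- j\<close> and the point \<open>- x - a\<close> so that \<open>cover\<close> and
    \<open>index_unique\<close> apply.\<close>
  also have "\<dots> = (\<integral>\<^sup>+ j. emeasure lborel (A \<inter> {a. G *v (- j) - (- x - a) \<in> P}) \<partial>count_space ?I)"
  proof (intro nn_integral_cong)
    fix j
    have "P \<inter> {v. v + (G *v j - x) \<in> A} = {v. v + (G *v j - x) \<in> A \<inter> {a. G *v (- j) - (- x - a) \<in> P}}"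
      by (auto simp: matrix_vector_mult_uminus)
    then show "emeasure lborel (P \<inter> {v. v + (G *v j - x) \<in> A}) = emeasure lborel (A \<inter> {a. G *v (- j) - (- x - a) \<in> P})"
      by (subst emeasure_lborel_translate[symmetric, where c = "G *v j - x"]) (auto intro!: measurable)
  qed
  also have "\<dots> = emeasure lborel (\<Union>j\<in>?I. A \<inter> {a. G *v (- j) - (- x - a) \<in> P})"
  proof (rule emeasure_UN_countable[OF _ countable_lattice_index, symmetric])
    show "disjoint_family_on (\<lambda>j. A \<inter> {a. G *v (- j) - (- x - a) \<in> P}) ?I"
    proof (unfold disjoint_family_on_def, intro ballI impI, rule ccontr)
      fix i j :: "real ^ 'n" assume ij: "i \<in> ?I" "j \<in> ?I" "i \<noteq> j"
        and "(A \<inter> {a. G *v (- i) - (- x - a) \<in> P}) \<inter> (A \<inter> {a. G *v (- j) - (- x - a) \<in> P}) \<noteq> {}"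
      then obtain a where "G *v (- i) - (- x - a) \<in> P" "G *v (- j) - (- x - a) \<in> P" by blast
      then have "- i = - j" by (intro index_unique) (use ij in \<open>auto simp: lattice_index_minus\<close>)
      with ij show False by simp
    qed
  qed measurable
  also have "(\<Union>j\<in>?I. A \<inter> {a. G *v (- j) - (- x - a) \<in> P}) = A"
  proof -
    have "\<exists>j\<in>?I. G *v (- j) - (- x - a) \<in> P" for a
      using cover[of "- x - a"] lattice_index_minus by (metis minus_minus)
    then show ?thesis by blast
  qed
  finally show ?thesis
    using P_pos A_pos by (simp add: emeasure_P_A p_def divide_ennreal)
qed

lemma emeasure_not_accepts: "emeasure U {v. \<not> accepts x v} = ennreal (1 - p)"
proof -
  interpret U: prob_space U by (rule prob_space_U)
  have "measure U {v. accepts x v} = p"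
    using emeasure_accepts[of x] p_pos by (simp add: U.emeasure_eq_measure)
  then show ?thesis
    using U.prob_neg[of "accepts x"] by (simp add: U.emeasure_eq_measure)
qed

section \<open>The state process and the accepted round\<close>

lemma space_rsuq_state[simp]: "space (rsuq_state P) = UNIV"
  by (simp add: rsuq_state_def space_PiM)

lemma prob_space_rsuq_state: "prob_space (rsuq_state P)"
  unfolding rsuq_state_def by (intro prob_space_PiM prob_space_U)

lemma measurable_rsuq_state_component[measurable]: "(\<lambda>s. s i) \<in> rsuq_state P \<rightarrow>\<^sub>M borel"
proof -
  have "(\<lambda>s. s i) \<in> rsuq_state P \<rightarrow>\<^sub>M U"
    unfolding rsuq_state_def by (rule measurable_component_singleton) simp
  then show ?thesis by (simp cong: measurable_cong_sets)
qed

lemma measurable_round_index[measurable]: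
  assumes [measurable]: "f \<in> M \<rightarrow>\<^sub>M borel" "g \<in> M \<rightarrow>\<^sub>M rsuq_state P"
  shows "(\<lambda>w. round_index (f w) (g w)) \<in> M \<rightarrow>\<^sub>M count_space UNIV"
  unfolding round_index_def
proof (rule measurable_Least)
  fix i
  have [measurable]: "(\<lambda>w. g w i) \<in> M \<rightarrow>\<^sub>M borel"
    by (rule measurable_compose[OF assms(2) measurable_rsuq_state_component])
  show "Measurable.pred M (\<lambda>w. accepts (f w) (g w i))" by measurable
qed

lemma measurable_rsuq[measurable]:
  assumes [measurable]: "f \<in> M \<rightarrow>\<^sub>M borel" "g \<in> M \<rightarrow>\<^sub>M rsuq_state P"
  shows "(\<lambda>w. rsuq G A P (f w) (g w)) \<in> M \<rightarrow>\<^sub>M borel"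
proof -
  have [measurable]: "(\<lambda>w. g w i) \<in> M \<rightarrow>\<^sub>M borel" for i
    by (rule measurable_compose[OF assms(2) measurable_rsuq_state_component])
  show ?thesis
    unfolding rsuq_eq
    \<comment> \<open>The round is random, so measurability is checked separately for each of its
      countably many values.\<close>
    by (rule measurable_compose_countable[where f = "\<lambda>i w. cell_quantizer G P (f w - g w i) + g w i"]) measurable
qed

lemma sets_no_accept_before: "{s. \<forall>i<m. \<not> accepts x (s i)} \<in> sets (rsuq_state P)"
proof -
  have "{s \<in> space (rsuq_state P). \<forall>i\<in>{..<m}. \<not> accepts x (s i)} \<in> sets (rsuq_state P)" by measurable
  then show ?thesis by (simp add: Ball_def)
qed

lemma emeasure_no_accept_before:
  "emeasure (rsuq_state P) {s. \<forall>i<m. \<not> accepts x (s i)} = ennreal ((1 - p) ^ m)"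
proof -
  interpret U: prob_space U by (rule prob_space_U)
  interpret product_prob_space "\<lambda>_ :: nat. U" UNIV ..
  have "emeasure (rsuq_state P) {s. \<forall>i<m. \<not> accepts x (s i)}
     = emeasure (Pi\<^sub>M UNIV (\<lambda>_ :: nat. U)) {s \<in> space (Pi\<^sub>M UNIV (\<lambda>_ :: nat. U)). \<forall>i\<in>{..<m}. s i \<in> {v. \<not> accepts x v}}"
    unfolding rsuq_state_def by (intro arg_cong2[where f = emeasure]) (auto simp: space_PiM)
  also have "\<dots> = (\<Prod>i\<in>{..<m}. emeasure U {v. \<not> accepts x v})"
    by (rule emeasure_PiM_Collect) auto
  finally show ?thesis
    using p_le_1 by (simp add: emeasure_not_accepts ennreal_power)
qed

text \<open>Never accepting entails rejection in the first \<open>m\<close> rounds, of probability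
  \<open>(1 - p) ^ m\<close>, and this tends to 0 since \<open>p\<close> is positive.\<close>

lemma AE_accepts: "AE s in rsuq_state P. \<exists>i. accepts x (s i)"
proof -
  let ?B = "{s. \<forall>i. \<not> accepts x (s i)}"
  have "{s \<in> space (rsuq_state P). \<forall>i. \<not> accepts x (s i)} \<in> sets (rsuq_state P)" by measurable
  then have B: "?B \<in> sets (rsuq_state P)" by simp
  have "emeasure (rsuq_state P) ?B \<le> ennreal ((1 - p) ^ m)" for m
    unfolding emeasure_no_accept_before[symmetric, of m x]
    using sets_no_accept_before by (rule emeasure_mono[rotated]) auto
  moreover have "(\<lambda>m. ennreal ((1 - p) ^ m)) \<longlonglongrightarrow> ennreal 0"
    using p_pos p_le_1 by (intro tendsto_ennrealI LIMSEQ_power_zero) auto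
  ultimately have "emeasure (rsuq_state P) ?B \<le> ennreal 0"
    by (intro LIMSEQ_le_const) auto
  then show ?thesis
    using B by (intro AE_I[of _ _ ?B]) auto
qed

text \<open>The mean is the sum of the tail probabilities, here dominated by a geometric
  series.\<close>

lemma nn_integral_round_index:
  "(\<integral>\<^sup>+ s. of_nat (round_index x s) \<partial>rsuq_state P) \<le> ennreal ((1 - p) / p)"
proof -
  have "(\<integral>\<^sup>+ s. of_nat (round_index x s) \<partial>rsuq_state P)
      = (\<Sum>t. emeasure (rsuq_state P) {s \<in> space (rsuq_state P). t < round_index x s})"
    by (rule nn_integral_nat_function) measurable
  also have "\<dots> \<le> (\<Sum>t. ennreal ((1 - p) ^ Suc t))"
    unfolding emeasure_no_accept_before[symmetric, of _ x]
  proof (intro suminf_le emeasure_mono)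
    \<comment> \<open>A round index above \<open>t\<close> means rejection in rounds
      \<open>0\<close> to \<open>t\<close>, hence \<open>Suc t\<close> factors. The inclusion also
      holds where no round accepts, whatever \<open>LEAST\<close> returns there.\<close>
    show "{s \<in> space (rsuq_state P). t < round_index x s} \<subseteq> {s. \<forall>i<Suc t. \<not> accepts x (s i)}" for t
      unfolding round_index_def by (auto simp: less_Suc_eq_le dest: le_less_trans not_less_Least)
  qed (auto intro: sets_no_accept_before)
  also have "\<dots> = ennreal ((1 - p) * (1 / (1 - (1 - p))))"
    using p_pos p_le_1 sums_mult[OF geometric_sums[of "1 - p"], of "1 - p"]
    by (intro suminf_ennreal_eq) (auto simp: mult.commute)
  finally show ?thesis by simp
qed


section \<open>Packing bound for a shifted lattice\<close>

text \<open>Disjoint copies of \<open>P\<close>, one for each lattice index involved, all lie in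
  \<open>D\<close>. Counting with \<open>emeasure (count_space UNIV)\<close> makes finiteness part
  of the bound.\<close>

lemma card_lattice_points_le:
  assumes D: "D \<in> sets lebesgue" "emeasure lebesgue D < \<infinity>"
    and B: "\<And>y u v. y \<in> B \<Longrightarrow> u \<in> P \<Longrightarrow> v \<in> P \<Longrightarrow> y + u - v \<in> D"
  shows "emeasure (count_space UNIV) {y \<in> B. \<exists>j\<in>lattice_index. y = G *v j + c}
    \<le> ennreal (measure lebesgue D / measure lebesgue P)"
proof -
  let ?J = "{j \<in> lattice_index. G *v j + c \<in> B}"
  obtain u0 where u0: "u0 \<in> P"
    using cover[of 0] by blast
  have J: "countable ?J"
    by (rule countable_subset[OF _ countable_lattice_index]) auto
  \<comment> \<open>\<open>V j\<close> is the copy of \<open>P\<close> whose base point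
    \<open>u0\<close> sits at \<open>y = G *v j + c\<close>. Its points are
    \<open>y + u - u0\<close> with \<open>u \<in> P\<close>, which is where the difference of two
    points of \<open>P\<close> in the definition of \<open>D\<close> comes from.\<close>
  define V where "V j = {v. v + (u0 - (G *v j + c)) \<in> P}" for j
  have V_meas: "V j \<in> sets borel" for j
    unfolding V_def by measurable
  have T_eq: "{y \<in> B. \<exists>j\<in>lattice_index. y = G *v j + c} = (\<lambda>j. G *v j + c) ` ?J"
    by auto
  have "emeasure (count_space UNIV) ((\<lambda>j. G *v j + c) ` ?J) \<le> emeasure (count_space UNIV) ?J"
    by (cases "finite ?J") (auto simp: emeasure_count_space card_image_le)
  then have "emeasure (count_space UNIV) {y \<in> B. \<exists>j\<in>lattice_index. y = G *v j + c} * emeasure lborel P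
      \<le> emeasure (count_space UNIV) ?J * emeasure lborel P"
    unfolding T_eq by (intro mult_right_mono) auto
  also have "\<dots> = (\<integral>\<^sup>+ j. emeasure lborel P \<partial>count_space ?J)"
    by (cases "finite ?J") (auto simp: emeasure_count_space mult.commute)
  also have "\<dots> = (\<integral>\<^sup>+ j. emeasure lborel (V j) \<partial>count_space ?J)"
    by (simp add: V_def emeasure_lborel_translate)
  also have "\<dots> = emeasure lborel (\<Union>j\<in>?J. V j)"
  proof (rule emeasure_UN_countable[OF _ J, symmetric])
    show "disjoint_family_on V ?J"
    proof (unfold disjoint_family_on_def, intro ballI impI, rule ccontr)
      fix i j assume ij: "i \<in> ?J" "j \<in> ?J" "i \<noteq> j" and "V i \<inter> V j \<noteq> {}"
      then obtain v where "v \<in> V i" "v \<in> V j" by blast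
      then have "i = j"
        using ij translates_disjoint[of i j "v + (u0 - (G *v i + c))" "v + (u0 - (G *v j + c))"]
        by (auto simp: V_def)
      with ij show False by simp
    qed
  qed (simp add: V_meas)
  also have "\<dots> = emeasure lebesgue (\<Union>j\<in>?J. V j)"
  proof -
    have "(\<Union>j\<in>?J. V j) \<in> sets lborel" using J V_meas by (intro sets.countable_UN') auto
    then show ?thesis by (simp add: emeasure_completion)
  qed
  also have "\<dots> \<le> emeasure lebesgue D"
  proof (intro emeasure_mono D(1) UN_least subsetI)
    fix j v assume "j \<in> ?J" "v \<in> V j"
    then show "v \<in> D"
      using B[of "G *v j + c" "v + (u0 - (G *v j + c))" u0] u0 by (simp add: V_def)
  qed
  also have "\<dots> = ennreal (measure lebesgue D / measure lebesgue P) * ennreal (measure lebesgue P)"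
    using D(2) P_pos by (subst ennreal_mult[symmetric]) (auto simp: emeasure_eq_ennreal_measure less_top)
  finally show ?thesis
    using P_pos by (subst (asm) (1 2) mult.commute) (simp add: emeasure_P_A ennreal_mult_le_mult_iff)
qed

section \<open>Logarithms of \<open>1 - p\<close>, and the output entropy for a fixed state\<close>

text \<open>This is \<open>ln z \<le> z - 1\<close> at \<open>z = 1 / (1 - p)\<close>; for
  \<open>p = 1\<close> the factor \<open>(1 - p) / p\<close> vanishes.\<close>

lemma log_one_minus_p_bound: "- ((1 - p) / p * log 2 (1 - p)) \<le> log 2 (exp 1)"
proof (cases "p = 1")
  case False
  then have p: "0 < p" "p < 1" using p_pos p_le_1 by auto
  have "ln (1 / (1 - p)) \<le> 1 / (1 - p) - 1"
    using p by (intro ln_le_minus_one) auto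
  then have "- ln (1 - p) * (1 - p) \<le> p"
    using p by (simp add: ln_div field_simps)
  then have "- ((1 - p) / p * ln (1 - p)) \<le> 1"
    using p by (simp add: field_simps)
  then have "- ((1 - p) / p * ln (1 - p)) / ln 2 \<le> 1 / ln 2"
    by (intro divide_right_mono) auto
  then show ?thesis
    by (simp add: log_def)
qed (simp add: log_def)

lemma log_one_minus_p_nonpos: "log 2 (1 - p) \<le> 0"
  \<comment> \<open>At \<open>p = 1\<close> the claim rests on the convention that the logarithm of
    0 is 0.\<close>
  using p_pos p_le_1 by (cases "p < 1") (auto simp: log_def[of 2 0])

text \<open>In the comparison weight, choosing for every point the least round whose shifted lattice
  contains it replaces the sum over \<open>k\<close> by its largest term.\<close>

lemma shannon_entropy_rsuq_le:
  assumes "prob_space M" and X[measurable]: "X \<in> M \<rightarrow>\<^sub>M borel"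
    and D: "D \<in> sets lebesgue" "emeasure lebesgue D < \<infinity>"
    and D_sup: "\<And>x a u v. x \<in> \<X> \<Longrightarrow> a \<in> A \<Longrightarrow> u \<in> P \<Longrightarrow> v \<in> P \<Longrightarrow> x + a + u - v \<in> D"
    and D_pos: "measure lebesgue D > 0"
    and acc: "AE w in M. X w \<in> \<X> \<and> (\<exists>i. accepts (X w) (s i)) \<and> (p = 1 \<longrightarrow> round_index (X w) s = 0)"
  shows "shannon_entropy (distr M borel (\<lambda>w. rsuq G A P (X w) s))
    \<le> (\<integral>\<^sup>+ w. ennreal (log 2 (measure lebesgue D / measure lebesgue A))
         + ennreal (- log 2 (1 - p)) * of_nat (round_index (X w) s) \<partial>M)"
proof -
  \<comment> \<open>\<open>T k\<close> holds the possible outputs of round \<open>k\<close>, at most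
    \<open>N\<close> of them, and \<open>g\<close> is the geometric law of the round. At
    \<open>p = 1\<close> only \<open>g 0\<close> is positive; \<open>C\<close> keeps just the rounds
    of positive weight, which makes \<open>r\<close> positive on it.\<close>
  define N where "N = measure lebesgue D / measure lebesgue P"
  define B where "B = {x + a | x a. x \<in> \<X> \<and> a \<in> A}"
  define T where "T k = {y \<in> B. \<exists>j\<in>lattice_index. y = G *v j + s k}" for k
  define g where "g k = p * (1 - p) ^ k" for k :: nat
  define C where "C = (\<Union>k\<in>{k. 0 < g k}. T k)"
  define kk where "kk y = (LEAST k. y \<in> T k)" for y
  define r where "r y = g (kk y) / N" for y
  have N_pos: "0 < N" using D_pos P_pos by (simp add: N_def)
  have g_nonneg: "0 \<le> g k" for k using p_pos p_le_1 by (simp add: g_def)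
  have g_mono: "g k \<le> g l" if "l \<le> k" for k l
    using p_pos p_le_1 that unfolding g_def by (intro mult_left_mono power_decreasing) auto
  have T_count: "countable (T k)" for k
  proof (rule countable_subset)
    show "T k \<subseteq> (\<lambda>j. G *v j + s k) ` lattice_index" by (auto simp: T_def)
  qed (intro countable_image countable_lattice_index)
  have T_card: "emeasure (count_space UNIV) (T k) \<le> ennreal N" for k
    unfolding T_def N_def using D
  proof (rule card_lattice_points_le)
    fix y u v assume "y \<in> B" "u \<in> P" "v \<in> P"
    then show "y + u - v \<in> D" using D_sup by (auto simp: B_def)
  qed
  have kk: "y \<in> T (kk y)" "kk y \<le> k" if "y \<in> T k" for y k
    using that unfolding kk_def by (auto intro: LeastI Least_le)
  have C_count: "countable C" unfolding C_def by (intro countable_UN T_count) auto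
  have out: "rsuq G A P x s \<in> T (round_index x s)" if "x \<in> \<X>" "\<exists>i. accepts x (s i)" for x
  proof -
    let ?k = "round_index x s"
    have a: "accepts x (s ?k)"
      unfolding round_index_def using that(2) by (rule LeastI_ex)
    obtain j where j: "j \<in> lattice_index" "G *v j - (x - s ?k) \<in> P" by (rule cover)
    then have eq: "rsuq G A P x s = G *v j + s ?k"
      by (simp add: rsuq_eq cell_quantizer_eq)
    have "rsuq G A P x s - x \<in> A"
      using a by (simp add: accepts_def rsuq_eq)
    then have "rsuq G A P x s \<in> B"
      using that(1) unfolding B_def by (intro CollectI exI[of _ x] exI[of _ "rsuq G A P x s - x"]) simp
    with eq j show ?thesis by (auto simp: T_def)
  qed
  have g_pos: "0 < g k" if "p = 1 \<longrightarrow> k = 0" for k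
    using that p_pos p_le_1 by (cases "p = 1") (auto simp: g_def)
  have "shannon_entropy (distr M borel (\<lambda>w. rsuq G A P (X w) s))
      \<le> (\<integral>\<^sup>+ w. ennreal (- log 2 (r (rsuq G A P (X w) s))) \<partial>M)"
    using \<open>prob_space M\<close> _ C_count
  proof (rule shannon_entropy_distr_le)
    show "(\<lambda>w. rsuq G A P (X w) s) \<in> M \<rightarrow>\<^sub>M borel"
      by (rule measurable_rsuq) auto
    show "AE w in M. rsuq G A P (X w) s \<in> C"
      using acc by eventually_elim (use out g_pos in \<open>auto simp: C_def\<close>)
    show "0 < r y" if "y \<in> C" for y
    proof -
      obtain k where "0 < g k" "y \<in> T k" using \<open>y \<in> C\<close> by (auto simp: C_def)
      then have "0 < g (kk y)" using g_mono kk(2) by (metis less_le_trans)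
      then show ?thesis using N_pos by (simp add: r_def)
    qed
    \<comment> \<open>The value \<open>r y\<close> is the term \<open>k = kk y\<close> of a series
      with nonnegative terms. Summing over \<open>y\<close> first, round \<open>k\<close>
      contributes at most \<open>N\<close> points of weight \<open>g k / N\<close>, so the total is
      at most the geometric sum 1.\<close>
    have "(\<integral>\<^sup>+ y. ennreal (r y) \<partial>count_space C)
        \<le> (\<integral>\<^sup>+ y. (\<Sum>k. ennreal (g k / N) * indicator (T k) y) \<partial>count_space C)"
    proof (rule nn_integral_mono)
      fix y assume "y \<in> space (count_space C)"
      then obtain k where "y \<in> T k" by (auto simp: C_def)
      then have "ennreal (r y) = (\<Sum>k\<in>{kk y}. ennreal (g k / N) * indicator (T k) y)"
        using kk(1) by (simp add: r_def)
      also have "\<dots> \<le> (\<Sum>k. ennreal (g k / N) * indicator (T k) y)"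
        by (rule sum_le_suminf) auto
      finally show "ennreal (r y) \<le> (\<Sum>k. ennreal (g k / N) * indicator (T k) y)" .
    qed
    also have "\<dots> = (\<Sum>k. ennreal (g k / N) * emeasure (count_space C) (T k \<inter> C))"
      by (subst nn_integral_suminf) (auto simp: nn_integral_cmult nn_integral_indicator')
    also have "\<dots> \<le> (\<Sum>k. ennreal (g k))"
    proof (intro suminf_le)
      fix k
      have "emeasure (count_space C) (T k \<inter> C) = emeasure (count_space UNIV) (T k \<inter> C)"
        by (cases "finite (T k \<inter> C)") (auto simp: emeasure_count_space)
      also have "\<dots> \<le> emeasure (count_space UNIV) (T k)"
        by (rule emeasure_mono) auto
      finally have "emeasure (count_space C) (T k \<inter> C) \<le> ennreal N"
        using T_card[of k] by (rule order_trans)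
      then have "ennreal (g k / N) * emeasure (count_space C) (T k \<inter> C) \<le> ennreal (g k / N) * ennreal N"
        by (rule mult_left_mono) simp
      also have "\<dots> = ennreal (g k)"
        using N_pos g_nonneg[of k] by (subst ennreal_mult[symmetric]) auto
      finally show "ennreal (g k / N) * emeasure (count_space C) (T k \<inter> C) \<le> ennreal (g k)" .
    qed auto
    also have "\<dots> = ennreal (p * (1 / (1 - (1 - p))))"
      unfolding g_def using p_pos p_le_1
      by (intro suminf_ennreal_eq sums_mult geometric_sums) auto
    finally show "(\<integral>\<^sup>+ y. ennreal (r y) \<partial>count_space C) \<le> 1"
      using p_pos by simp
  qed
  also have "\<dots> \<le> (\<integral>\<^sup>+ w. ennreal (log 2 (measure lebesgue D / measure lebesgue A))
         + ennreal (- log 2 (1 - p)) * of_nat (round_index (X w) s) \<partial>M)"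
  proof (rule nn_integral_mono_AE, use acc in eventually_elim)
    fix w assume w: "X w \<in> \<X> \<and> (\<exists>i. accepts (X w) (s i)) \<and> (p = 1 \<longrightarrow> round_index (X w) s = 0)"
    let ?k = "round_index (X w) s" and ?y = "rsuq G A P (X w) s"
    have T: "?y \<in> T ?k" using w out by auto
    have gk: "0 < g ?k" using w by (intro g_pos) auto
    \<comment> \<open>The round \<open>?k\<close> need not be the least one, \<open>kk ?y\<close>,
      but the weights decrease, so \<open>r\<close> at the output is at least the weight of the
      round really used.\<close>
    have le: "g ?k / N \<le> r ?y"
      unfolding r_def using N_pos kk(2)[OF T] by (intro divide_right_mono g_mono) auto
    \<comment> \<open>For \<open>p = 1\<close> the hypothesis on \<open>w\<close> forces
      \<open>?k = 0\<close>, and the product with \<open>log 2 (1 - p)\<close> disappears.\<close>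
    have "log 2 (g ?k) = log 2 p + real ?k * log 2 (1 - p)"
      using w p_pos p_le_1 by (cases "p = 1") (auto simp: g_def log_mult log_nat_power)
    moreover have "log 2 (measure lebesgue D / measure lebesgue A) = log 2 N - log 2 p"
      using D_pos A_pos P_pos by (simp add: N_def p_def log_divide)
    moreover have "log 2 (g ?k / N) \<le> log 2 (r ?y)"
      using le gk N_pos by (intro log_le_cancel_iff[THEN iffD2]) (auto intro: less_le_trans[OF divide_pos_pos])
    ultimately have "- log 2 (r ?y) \<le> log 2 (measure lebesgue D / measure lebesgue A) + (- log 2 (1 - p)) * real ?k"
      using gk N_pos by (simp add: log_divide algebra_simps)
    then have "ennreal (- log 2 (r ?y))
        \<le> ennreal (log 2 (measure lebesgue D / measure lebesgue A) + (- log 2 (1 - p)) * real ?k)"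
      by (rule ennreal_leI)
    also have "\<dots> \<le> ennreal (log 2 (measure lebesgue D / measure lebesgue A)) + ennreal (- log 2 (1 - p) * real ?k)"
      using log_one_minus_p_nonpos by (intro ennreal_add_le mult_nonneg_nonneg) auto
    also have "ennreal (- log 2 (1 - p) * real ?k) = ennreal (- log 2 (1 - p)) * of_nat ?k"
      using log_one_minus_p_nonpos by (subst ennreal_mult) (auto simp: ennreal_of_nat_eq_real_of_nat)
    finally show "ennreal (- log 2 (r ?y)) \<le> ennreal (log 2 (measure lebesgue D / measure lebesgue A))
         + ennreal (- log 2 (1 - p)) * of_nat ?k" .
  qed
  finally show ?thesis .
qed

section \<open>Averaging over the state\<close>

text \<open>The packing bound for the single point \<open>x + a\<close> says that at least one cell
  fits into \<open>D\<close>. This makes the volume of \<open>D\<close> positive and the logarithm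
  of its ratio to that of \<open>A\<close> nonnegative.\<close>

lemma measure_P_le:
  assumes D: "D \<in> sets lebesgue" "emeasure lebesgue D < \<infinity>"
    and x: "x \<in> \<X>"
    and D_sup: "\<And>x a u v. x \<in> \<X> \<Longrightarrow> a \<in> A \<Longrightarrow> u \<in> P \<Longrightarrow> v \<in> P \<Longrightarrow> x + a + u - v \<in> D"
  shows "measure lebesgue P \<le> measure lebesgue D"
proof -
  obtain a where a: "a \<in> A" using A_pos by fastforce
  have "0 \<in> (lattice_index :: (real ^ 'n) set)" by (simp add: lattice_index_def)
  then have "{y \<in> {x + a}. \<exists>j\<in>lattice_index. y = G *v j + (x + a)} = {x + a}"
    by (auto intro!: bexI[of _ 0])
  then have "emeasure (count_space UNIV) {x + a} \<le> ennreal (measure lebesgue D / measure lebesgue P)"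
    using card_lattice_points_le[OF D, of "{x + a}" "x + a"] D_sup[OF x a] by auto
  then have "ennreal 1 \<le> ennreal (measure lebesgue D / measure lebesgue P)"
    by (simp add: emeasure_count_space)
  then have "1 \<le> measure lebesgue D / measure lebesgue P"
    by (subst (asm) ennreal_le_iff) auto
  then show ?thesis using P_pos by simp
qed

text \<open>\<open>D\<close> may be any measurable set of finite measure containing the Minkowski
  sum, so that a ball can serve in the asymptotic statement.\<close>

lemma cond_entropy_rsuq_le:
  assumes "prob_space M" and X[measurable]: "X \<in> M \<rightarrow>\<^sub>M borel"
    and S: "S \<in> M \<rightarrow>\<^sub>M rsuq_state P" "distr M (rsuq_state P) S = rsuq_state P"
    and joint: "distr M borel X \<Otimes>\<^sub>M distr M (rsuq_state P) S
      = distr M (borel \<Otimes>\<^sub>M rsuq_state P) (\<lambda>w. (X w, S w))"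
    and X_in: "AE w in M. X w \<in> \<X>"
    and D: "D \<in> sets lebesgue" "emeasure lebesgue D < \<infinity>"
    and D_sup: "\<And>x a u v. x \<in> \<X> \<Longrightarrow> a \<in> A \<Longrightarrow> u \<in> P \<Longrightarrow> v \<in> P \<Longrightarrow> x + a + u - v \<in> D"
  shows "0 < measure lebesgue D"
    and "enn2ereal (cond_entropy M (rsuq_state P) borel S (\<lambda>w. rsuq G A P (X w) (S w)))
      \<le> ereal (log 2 (measure lebesgue D) - log 2 (measure lebesgue A) - (1 - p) / p * log 2 (1 - p))"
proof -
  interpret M: prob_space M by fact
  interpret PS: prob_space "rsuq_state P" by (rule prob_space_rsuq_state)
  interpret pair_sigma_finite M "rsuq_state P" ..
  let ?c = "log 2 (measure lebesgue D / measure lebesgue A)" and ?d = "- log 2 (1 - p)"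
  obtain w where "X w \<in> \<X>"
    using eventually_happens'[OF _ X_in] M.AE_False by (metis trivial_limit_def eventually_ae_filter)
  then have P_le_D: "measure lebesgue P \<le> measure lebesgue D"
    using measure_P_le[OF D _ D_sup] by blast
  then show D_pos: "0 < measure lebesgue D" using P_pos by linarith
  have c: "0 \<le> ?c"
    using P_le_D measure_A_le_P A_pos D_pos by simp
  have d: "0 \<le> ?d" "0 \<le> (1 - p) / p"
    using log_one_minus_p_nonpos p_pos p_le_1 by auto
  \<comment> \<open>For \<open>p = 1\<close> the mean of the round index is 0, so the first
    candidate is accepted almost surely.\<close>
  have AE1: "AE s in rsuq_state P. (\<exists>i. accepts x (s i)) \<and> (p = 1 \<longrightarrow> round_index x s = 0)" for x
  proof (cases "p = 1")
    case True
    then have "(\<integral>\<^sup>+ s. of_nat (round_index x s) \<partial>rsuq_state P) = 0"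
      using nn_integral_round_index[of x] by simp
    then have "AE s in rsuq_state P. of_nat (round_index x s) = (0 :: ennreal)"
      by (subst (asm) nn_integral_0_iff_AE) auto
    with AE_accepts[of x] show ?thesis by eventually_elim simp
  qed (use AE_accepts in simp)
  have "AE w in M. AE s in rsuq_state P. (\<exists>i. accepts (X w) (s i)) \<and> (p = 1 \<longrightarrow> round_index (X w) s = 0)"
    using AE1 by simp
  \<comment> \<open>Acceptance is known almost surely for each fixed input, whereas the entropy
    bound wants it for a fixed state; Fubini exchanges the two.\<close>
  then have "AE s in rsuq_state P. AE w in M. (\<exists>i. accepts (X w) (s i)) \<and> (p = 1 \<longrightarrow> round_index (X w) s = 0)"
    by (subst AE_commute[symmetric]) measurable
  then have AE2: "AE s in rsuq_state P. AE w in M. X w \<in> \<X> \<and> (\<exists>i. accepts (X w) (s i)) \<and> (p = 1 \<longrightarrow> round_index (X w) s = 0)"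
  proof eventually_elim
    case (elim s)
    with X_in show ?case by eventually_elim simp
  qed
  have "regular_cond_distr M (rsuq_state P) borel S (\<lambda>w. rsuq G A P (X w) (S w))
      (\<lambda>s. distr M borel (\<lambda>w. rsuq G A P (X w) s))"
    using \<open>prob_space M\<close> X S(1) joint by (rule regular_cond_distr_indep) measurable
  then have "cond_entropy M (rsuq_state P) borel S (\<lambda>w. rsuq G A P (X w) (S w))
      = (\<integral>\<^sup>+ s. shannon_entropy (distr M borel (\<lambda>w. rsuq G A P (X w) s)) \<partial>rsuq_state P)"
    using cond_entropy_eq[OF \<open>prob_space M\<close> S(1)] by (simp add: S(2))
  also have "\<dots> \<le> (\<integral>\<^sup>+ s. \<integral>\<^sup>+ w. ennreal ?c + ennreal ?d * of_nat (round_index (X w) s) \<partial>M \<partial>rsuq_state P)"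
  proof (rule nn_integral_mono_AE, use AE2 in eventually_elim)
    case (elim s)
    show ?case by (rule shannon_entropy_rsuq_le[OF \<open>prob_space M\<close> X D D_sup D_pos elim])
  qed
  \<comment> \<open>The mean of the round index is controlled only with the input fixed and the
    state random, so the state is integrated first.\<close>
  also have "\<dots> = (\<integral>\<^sup>+ w. \<integral>\<^sup>+ s. ennreal ?c + ennreal ?d * of_nat (round_index (X w) s) \<partial>rsuq_state P \<partial>M)"
    by (rule Fubini') measurable
  also have "\<dots> \<le> (\<integral>\<^sup>+ w. ennreal ?c + ennreal ?d * ennreal ((1 - p) / p) \<partial>M)"
  proof (rule nn_integral_mono)
    fix w
    have "(\<integral>\<^sup>+ s. ennreal ?c + ennreal ?d * of_nat (round_index (X w) s) \<partial>rsuq_state P)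
        = ennreal ?c + ennreal ?d * (\<integral>\<^sup>+ s. of_nat (round_index (X w) s) \<partial>rsuq_state P)"
      by (subst nn_integral_add) (auto simp: nn_integral_cmult PS.emeasure_space_1[simplified])
    also have "\<dots> \<le> ennreal ?c + ennreal ?d * ennreal ((1 - p) / p)"
      by (intro add_left_mono mult_left_mono nn_integral_round_index) auto
    finally show "(\<integral>\<^sup>+ s. ennreal ?c + ennreal ?d * of_nat (round_index (X w) s) \<partial>rsuq_state P)
        \<le> ennreal ?c + ennreal ?d * ennreal ((1 - p) / p)" .
  qed
  also have "\<dots> = ennreal (?c + ?d * ((1 - p) / p))"
    using c d ennreal_plus[OF c mult_nonneg_nonneg[OF d]] ennreal_mult[OF d] by (simp add: M.emeasure_space_1)
  finally have "enn2ereal (cond_entropy M (rsuq_state P) borel S (\<lambda>w. rsuq G A P (X w) (S w)))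
      \<le> enn2ereal (ennreal (?c + ?d * ((1 - p) / p)))"
    by (simp add: less_eq_ennreal.rep_eq)
  also have "\<dots> = ereal (?c + ?d * ((1 - p) / p))"
    using c d by (intro enn2ereal_ennreal add_nonneg_nonneg mult_nonneg_nonneg)
  also have "?c + ?d * ((1 - p) / p) = log 2 (measure lebesgue D) - log 2 (measure lebesgue A) - (1 - p) / p * log 2 (1 - p)"
    using D_pos A_pos by (simp add: log_divide algebra_simps)
  finally show "enn2ereal (cond_entropy M (rsuq_state P) borel S (\<lambda>w. rsuq G A P (X w) (S w)))
      \<le> ereal (log 2 (measure lebesgue D) - log 2 (measure lebesgue A) - (1 - p) / p * log 2 (1 - p))" .
qed

section \<open>Inputs uniform on growing balls\<close>

lemma normalized_entropy_rsuq_le: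
  "normalized_entropy (rsuq_state P) (rsuq G A P)
     \<le> ereal (- log 2 (measure lebesgue A) - (1 - p) / p * log 2 (1 - p))"
proof -
  obtain R where R: "0 < R" "\<And>x. x \<in> P \<Longrightarrow> norm x \<le> R"
    using bounded_P by (auto simp: bounded_pos)
  define b where "b = - log 2 (measure lebesgue A) - (1 - p) / p * log 2 (1 - p)"
  define vol where "vol \<tau> = measure lebesgue (cball (0 :: real ^ 'n) \<tau>)" for \<tau>
  let ?f = "\<lambda>\<tau>. enn2ereal (cond_entropy (uniform_measure lborel (cball 0 \<tau>) \<Otimes>\<^sub>M rsuq_state P) (rsuq_state P) borel
                    snd (\<lambda>(x, s). rsuq G A P x s)) - ereal (log 2 (vol \<tau>))"
  \<comment> \<open>Points of \<open>A\<close>, \<open>P\<close> and again \<open>P\<close> have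
    norm at most \<open>R\<close>, so the enlarged ball has radius \<open>\<tau> + 3 * R\<close>.
    The ratio of the radii is \<open>1 + 3 * R / \<tau>\<close>, and its power
    \<open>CARD('n)\<close> is the ratio of the volumes.\<close>
  let ?g = "\<lambda>\<tau>. b + real CARD('n) * log 2 (1 + 3 * R / \<tau>)"
  have vol: "vol \<tau> = unit_ball_vol (real CARD('n)) * \<tau> ^ CARD('n)" if "0 \<le> \<tau>" for \<tau>
    using that by (simp add: vol_def content_cball)
  have f_le: "?f \<tau> \<le> ereal (?g \<tau>)" if \<tau>: "0 < \<tau>" for \<tau>
  proof -
    let ?U = "uniform_measure lborel (cball (0 :: real ^ 'n) \<tau>)" and ?D = "cball (0 :: real ^ 'n) (\<tau> + 3 * R)"
    let ?M = "?U \<Otimes>\<^sub>M rsuq_state P"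
    have vol_pos: "0 < vol \<tau>" "0 < vol (\<tau> + 3 * R)"
      using \<tau> R(1) by (auto simp: vol unit_ball_vol_pos intro!: mult_pos_pos)
    interpret U: prob_space ?U
      using vol_pos(1) emeasure_lborel_cball_finite[of 0 \<tau>]
      by (intro prob_space_uniform_measure) (auto simp: vol_def measure_def)
    interpret PS: prob_space "rsuq_state P" by (rule prob_space_rsuq_state)
    interpret pair_prob_space ?U "rsuq_state P" ..
    have m: "fst \<in> ?M \<rightarrow>\<^sub>M borel" "snd \<in> ?M \<rightarrow>\<^sub>M rsuq_state P"
      by (simp_all cong: measurable_cong_sets)
    have d1: "distr ?M borel fst = ?U"
      using PS.distr_pair_fst[of ?U] by (simp cong: distr_cong)
    have d2: "distr ?M (rsuq_state P) snd = rsuq_state P"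
    proof (rule measure_eqI)
      fix E assume "E \<in> sets (distr ?M (rsuq_state P) snd)"
      then have E: "E \<in> sets (rsuq_state P)" by simp
      then have "emeasure (distr ?M (rsuq_state P) snd) E = emeasure ?M (space ?U \<times> E)"
        using m(2) by (subst emeasure_distr) (auto intro!: arg_cong[where f = "emeasure ?M"] simp: space_pair_measure)
      also have "\<dots> = emeasure (rsuq_state P) E"
        using E U.emeasure_space_1 by (subst PS.emeasure_pair_measure_Times) auto
      finally show "emeasure (distr ?M (rsuq_state P) snd) E = emeasure (rsuq_state P) E" .
    qed simp
    \<comment> \<open>Together the two projections are the identity on the product space, whose
      measure is already a product.\<close>
    have joint: "distr ?M borel fst \<Otimes>\<^sub>M distr ?M (rsuq_state P) snd = distr ?M (borel \<Otimes>\<^sub>M rsuq_state P) (\<lambda>w. (fst w, snd w))"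
      unfolding d1 d2 by (simp add: distr_id2 cong: sets_pair_measure_cong)
    have X_in: "AE w in ?M. fst w \<in> cball 0 \<tau>"
    proof (rule AE_distrD[OF m(1)])
      show "AE x in distr ?M borel fst. x \<in> cball 0 \<tau>"
        unfolding d1 by (rule AE_uniform_measureI) auto
    qed
    have D_sup: "x + a + u - v \<in> ?D" if "x \<in> cball 0 \<tau>" "a \<in> A" "u \<in> P" "v \<in> P" for x a u v
    proof -
      have "norm (x + a + u - v) \<le> norm x + norm a + norm u + norm v" by norm
      then show ?thesis using that R(2)[of a] R(2)[of u] R(2)[of v] A_sub by auto
    qed
    have D: "?D \<in> sets lebesgue" by simp
    have D_fin: "emeasure lebesgue ?D < \<infinity>"
      using emeasure_lborel_cball_finite[of "0 :: real ^ 'n" "\<tau> + 3 * R"] by simp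
    have "enn2ereal (cond_entropy ?M (rsuq_state P) borel snd (\<lambda>w. rsuq G A P (fst w) (snd w)))
        \<le> ereal (log 2 (vol (\<tau> + 3 * R)) - log 2 (measure lebesgue A) - (1 - p) / p * log 2 (1 - p))"
      unfolding vol_def
      by (rule cond_entropy_rsuq_le(2)[OF prob_space_axioms m d2 joint X_in D D_fin D_sup])
    moreover have "log 2 (vol (\<tau> + 3 * R)) = log 2 (vol \<tau>) + real CARD('n) * log 2 (1 + 3 * R / \<tau>)"
    proof -
      have "vol (\<tau> + 3 * R) = vol \<tau> * (1 + 3 * R / \<tau>) ^ CARD('n)"
        using \<tau> R(1) by (simp add: vol power_mult_distrib[symmetric] distrib_left)
      moreover have "0 < 1 + 3 * R / \<tau>" using \<tau> R(1) by (intro add_pos_pos) auto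
      ultimately show ?thesis
        using vol_pos by (simp add: log_mult log_nat_power)
    qed
    ultimately have "enn2ereal (cond_entropy ?M (rsuq_state P) borel snd (\<lambda>(x, s). rsuq G A P x s))
        \<le> ereal (log 2 (vol \<tau>) + ?g \<tau>)"
      by (simp add: case_prod_unfold b_def algebra_simps)
    then show ?thesis
      by (cases "enn2ereal (cond_entropy ?M (rsuq_state P) borel snd (\<lambda>(x, s). rsuq G A P x s))") auto
  qed
  have "Limsup at_top ?f \<le> Limsup at_top (\<lambda>\<tau>. ereal (?g \<tau>))"
    by (intro Limsup_mono eventually_mono[OF eventually_gt_at_top[of 0]] f_le)
  also have "\<dots> = ereal b"
  proof (rule lim_imp_Limsup)
    have "((\<lambda>\<tau>. 3 * R / \<tau>) \<longlongrightarrow> 0) at_top"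
      by (intro tendsto_divide_0[OF tendsto_const] filterlim_at_top_imp_at_infinity filterlim_ident)
    then have "(?g \<longlongrightarrow> b + real CARD('n) * log 2 (1 + 0)) at_top"
      by (intro tendsto_intros) auto
    then show "((\<lambda>\<tau>. ereal (?g \<tau>)) \<longlongrightarrow> ereal b) at_top" by simp
  qed simp
  finally show ?thesis
    by (simp add: normalized_entropy_def b_def vol_def)
qed

end

theorem theorem6:
  fixes G :: "real ^ 'n ^ 'n" and P A :: "(real ^ 'n) set" and p :: real
  assumes full_rank: "rank G = CARD('n)"
    and cell: "basic_cell G P"
    and P_borel: "P \<in> sets borel"
    and A_borel: "A \<in> sets borel"
    and A_sub: "A \<subseteq> P"
    and A_pos: "measure lebesgue A > 0"
    and p_def: "p = measure lebesgue A / measure lebesgue P"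
  shows
    "(\<forall>(M :: 'w measure) (X :: 'w \<Rightarrow> real ^ 'n) (S :: 'w \<Rightarrow> nat \<Rightarrow> real ^ 'n) \<X> D.
        prob_space M \<and>
        X \<in> M \<rightarrow>\<^sub>M borel \<and>
        S \<in> M \<rightarrow>\<^sub>M rsuq_state P \<and>
        distr M (rsuq_state P) S = rsuq_state P \<and>
        prob_space.indep_set M (sets (vimage_algebra (space M) X borel))
          (sets (vimage_algebra (space M) S (rsuq_state P))) \<and>
        \<X> \<in> sets lebesgue \<and> emeasure lebesgue \<X> < \<infinity> \<and>
        (AE w in M. X w \<in> \<X>) \<and>
        D = {x + a + u - v | x a u v. x \<in> \<X> \<and> a \<in> A \<and> u \<in> P \<and> v \<in> P} \<and>
        D \<in> sets lebesgue \<longrightarrow>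
          enn2ereal (cond_entropy M (rsuq_state P) borel S (\<lambda>w. rsuq G A P (X w) (S w)))
            \<le> elog2 (emeasure lebesgue D) - ereal (log 2 (measure lebesgue A))
               - ereal ((1 - p) / p * log 2 (1 - p)) \<and>
          elog2 (emeasure lebesgue D) - ereal (log 2 (measure lebesgue A))
               - ereal ((1 - p) / p * log 2 (1 - p))
            \<le> elog2 (emeasure lebesgue D) - ereal (log 2 (measure lebesgue A))
               + ereal (log 2 (exp 1))) \<and>
     normalized_entropy (rsuq_state P) (rsuq G A P)
       \<le> ereal (- log 2 (measure lebesgue A) - (1 - p) / p * log 2 (1 - p)) \<and>
     - log 2 (measure lebesgue A) - (1 - p) / p * log 2 (1 - p)
       \<le> - log 2 (measure lebesgue A) + log 2 (exp 1)"
proof -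
  interpret cell_subset G P A p
    using assms by unfold_locales
  show ?thesis
  proof (intro conjI allI impI; (elim conjE)?)
    fix M :: "'w measure" and X :: "'w \<Rightarrow> real ^ 'n" and S :: "'w \<Rightarrow> nat \<Rightarrow> real ^ 'n" and \<X> D
    assume M: "prob_space M" and X: "X \<in> M \<rightarrow>\<^sub>M borel" and S: "S \<in> M \<rightarrow>\<^sub>M rsuq_state P"
      "distr M (rsuq_state P) S = rsuq_state P"
      and indep: "prob_space.indep_set M (sets (vimage_algebra (space M) X borel))
          (sets (vimage_algebra (space M) S (rsuq_state P)))"
      and X_in: "AE w in M. X w \<in> \<X>"
      and D_eq: "D = {x + a + u - v | x a u v. x \<in> \<X> \<and> a \<in> A \<and> u \<in> P \<and> v \<in> P}"
      and D: "D \<in> sets lebesgue"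
    interpret prob_space M by fact
    note joint = indep_set_imp_distr_pair[OF X S(1) indep]
    have D_sup: "x + a + u - v \<in> D" if "x \<in> \<X>" "a \<in> A" "u \<in> P" "v \<in> P" for x a u v
      using that D_eq by blast
    let ?L = "elog2 (emeasure lebesgue D)"
    show "enn2ereal (cond_entropy M (rsuq_state P) borel S (\<lambda>w. rsuq G A P (X w) (S w)))
            \<le> ?L - ereal (log 2 (measure lebesgue A)) - ereal ((1 - p) / p * log 2 (1 - p))"
    \<comment> \<open>If \<open>D\<close> has infinite volume, the right-hand side is
      \<open>\<infinity>\<close>.\<close>
    proof (cases "emeasure lebesgue D = \<infinity>")
      case True
      then show ?thesis by (simp add: elog2_def)
    next
      case False
      then have fin: "emeasure lebesgue D < \<infinity>" by (simp add: less_top)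
      note * = cond_entropy_rsuq_le[OF M X S joint X_in D fin D_sup]
      \<comment> \<open>Positivity of the volume of \<open>D\<close> excludes the value
        \<open>-\<infinity>\<close> of \<open>elog2\<close>.\<close>
      have "?L = ereal (log 2 (measure lebesgue D))"
        using *(1) False by (auto simp: elog2_def measure_def)
      with *(2) show ?thesis by simp
    qed
    show "?L - ereal (log 2 (measure lebesgue A)) - ereal ((1 - p) / p * log 2 (1 - p))
            \<le> ?L - ereal (log 2 (measure lebesgue A)) + ereal (log 2 (exp 1))"
      using log_one_minus_p_bound by (cases ?L) auto
  next
    show "normalized_entropy (rsuq_state P) (rsuq G A P)
       \<le> ereal (- log 2 (measure lebesgue A) - (1 - p) / p * log 2 (1 - p))"
      by (rule normalized_entropy_rsuq_le)
    show "- log 2 (measure lebesgue A) - (1 - p) / p * log 2 (1 - p)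
       \<le> - log 2 (measure lebesgue A) + log 2 (exp 1)"
      using log_one_minus_p_bound by simp
  qed
qed

end
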